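(* Let $(A,1_l)$ be a left-unital algebra. The following statements are true. (B1) The subalgebra $Twist(A)$ of all HA-compatible maps on $(A,1_l)$ is in bijection with the commutative associative subalgebra $AC_l(A)\cdot 1_l=\{a\in AC_l(A)\mid a\cdot 1_l=a\}$. The bijection is given by $\phi$ and the restriction $\psi\vert_{AC_l(A)\cdot 1_l}$, where $\phi\colon Twist(A)\to A$, $\alpha\mapsto\alpha(1_l)$, and $\psi\colon AC_l(A)\to\mathcal{L}(A)$, $a\mapsto L_a$. (B2) For every $a\in AC_l(A)$, $(A,L_a,1_l)$ is hom-associative. (B3) Multiplicative HA-compatible maps on $(A,1_l)$ are in bijection with the subset $E(A)\cap AC_l(A)\cdot 1_l$ of idempotents in $AC_l(A)\cdot 1_l$. (B4) If $(A,1_l)$ is moreover associative, then HA-compatible maps of $(A,1_l)$ are in bijection with the commutative associative subalgebra $$AC_l(A)=\{a\in A\mid a\cdot x\cdot z=x\cdot a\cdot z\ \ \forall x,z\in A\}.$$ The bijection is given by $a\leftrightarrow L_a$. Moreover, $AC_l(A)$ satisfies the following properties: 1) $Z(A)\subseteq AC_l(A)$; 2) if $(A,1_l)$ is two-sided unital, a domain or commutative, then $AC_l(A)=Z(A)=AC_l(A)\cdot 1_l=HU_n^l(A)$.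
   Context: An algebra $A$ over a field $\mathbb{F}$ is a linear space with a bilinear product $(x,y)\mapsto x\cdot y$ (not assumed associative or commutative). It is left-unital if equipped with $1_l\in A$ such that $1_l\cdot x=x$ for all $x\in A$; it is two-sided unital if moreover $x\cdot 1_l=x$ for all $x$. $\mathcal{L}(A)$ is the algebra of linear maps $A\to A$ under composition, and $L_a\colon x\mapsto a\cdot x$. A linear map $\alpha\colon A\to A$ is HA-compatible if $(A,\alpha)$ is hom-associative, i.e. $\alpha(x)\cdot(y\cdot z)=(x\cdot y)\cdot\alpha(z)$ for all $x,y,z\in A$; $Twist(A)\subseteq\mathcal{L}(A)$ is the set of HA-compatible maps. $\alpha$ is multiplicative if $\alpha(x\cdot y)=\alpha(x)\cdot\alpha(y)$ for all $x,y$. $E(A)=\{e\in A\mid e\cdot e=e\}$. Define $$AC_l(A)=\{a\in A\mid a\cdot(x\cdot z)=x\cdot(a\cdot z),\ (a\cdot x)\cdot(y\cdot z)=a\cdot((x\cdot y)\cdot z)\ \forall x,y,z\in A\},$$ $$AC_l(A)\cdot 1_l=\{a\cdot 1_l\mid a\in AC_l(A)\},$$ $$HU_n^l(A)=Z(A\cdot A)\cap N^l(A)\cap N^m(A)\cap Ann_A^l([A,A,A]_{\mathrm{as}}),$$ where $A\cdot A$ is the set (span) of products, equal to $A$ since $A$ is left-unital. Here $[x,y,z]_{\mathrm{as}}=(x\cdot y)\cdot z-x\cdot(y\cdot z)$, $[A,A,A]_{\mathrm{as}}$ is the set of all associators, $Z(A)=\{a\mid a\cdot x=x\cdot a\ \forall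 x\in A\}$, $N^l(A)=\{a\mid [a,s,t]_{\mathrm{as}}=0\ \forall s,t\in A\}$, $N^m(A)=\{a\mid [s,a,t]_{\mathrm{as}}=0\ \forall s,t\in A\}$, and $Ann_A^l(S)=\{a\in A\mid a\cdot s=0\ \forall s\in S\}$. An associative domain is an associative algebra in which every nonzero element $a$ satisfies $a\cdot x\neq 0$ and $x\cdot a\neq 0$ for all $x\neq 0$.
   Formalization: In (B4), commutativity of AC_l(A) and the bijection a↔L_a from AC_l(A), false in general, are claimed only if A is two-sided unital, a domain or commutative; otherwise AC_l(A) is an associative subalgebra mapped onto the HA-compatible maps, bijectively from AC_l(A)·1_l. *)

theory Defs
  imports "HOL.Vector_Spaces" "HOL-Library.Function_Algebras"
begin

(* The algebra A is a whole type 'a; scale is the scalar multiplication by the field 'f and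
   mult the (possibly non-associative, non-commutative) product. *)

locale algebra_over_field = vector_space scale
  for scale :: "'f::field \<Rightarrow> 'a::ab_group_add \<Rightarrow> 'a" +
  fixes mult :: "'a \<Rightarrow> 'a \<Rightarrow> 'a"
  assumes mult_linear_right: "Vector_Spaces.linear scale scale (\<lambda>y. mult x y)"
    and mult_linear_left: "Vector_Spaces.linear scale scale (\<lambda>x. mult x y)"

locale left_unital_algebra = algebra_over_field scale mult
  for scale :: "'f::field \<Rightarrow> 'a::ab_group_add \<Rightarrow> 'a" and mult :: "'a \<Rightarrow> 'a \<Rightarrow> 'a" +
  fixes one :: 'a
  assumes left_unit: "mult one x = x"

definition two_sided_unital :: "('a \<Rightarrow> 'a \<Rightarrow> 'a) \<Rightarrow> 'a \<Rightarrow> bool" where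
  "two_sided_unital mult e \<longleftrightarrow> (\<forall>x. mult e x = x \<and> mult x e = x)"

definition associative_on :: "('a \<Rightarrow> 'a \<Rightarrow> 'a) \<Rightarrow> 'a set \<Rightarrow> bool" where
  "associative_on mult S \<longleftrightarrow>
     (\<forall>x\<in>S. \<forall>y\<in>S. \<forall>z\<in>S. mult (mult x y) z = mult x (mult y z))"

definition commutative_on :: "('a \<Rightarrow> 'a \<Rightarrow> 'a) \<Rightarrow> 'a set \<Rightarrow> bool" where
  "commutative_on mult S \<longleftrightarrow> (\<forall>x\<in>S. \<forall>y\<in>S. mult x y = mult y x)"

definition associative_domain :: "('a::zero \<Rightarrow> 'a \<Rightarrow> 'a) \<Rightarrow> bool" where
  "associative_domain mult \<longleftrightarrow> associative_on mult UNIV \<and>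
     (\<forall>a. a \<noteq> 0 \<longrightarrow> (\<forall>x. x \<noteq> 0 \<longrightarrow> mult a x \<noteq> 0 \<and> mult x a \<noteq> 0))"

(* Subalgebras are not required to contain a unit. *)

definition subalgebra ::
    "('f::field \<Rightarrow> 'a::ab_group_add \<Rightarrow> 'a) \<Rightarrow> ('a \<Rightarrow> 'a \<Rightarrow> 'a) \<Rightarrow> 'a set \<Rightarrow> bool" where
  "subalgebra scale mult S \<longleftrightarrow>
     module.subspace scale S \<and> (\<forall>x\<in>S. \<forall>y\<in>S. mult x y \<in> S)"

definition linear_maps :: "('f::field \<Rightarrow> 'a::ab_group_add \<Rightarrow> 'a) \<Rightarrow> ('a \<Rightarrow> 'a) set" where
  "linear_maps scale = {\<alpha>. Vector_Spaces.linear scale scale \<alpha>}"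

definition scale_map :: "('f \<Rightarrow> 'a \<Rightarrow> 'a) \<Rightarrow> 'f \<Rightarrow> ('a \<Rightarrow> 'a) \<Rightarrow> ('a \<Rightarrow> 'a)" where
  "scale_map scale c \<alpha> = (\<lambda>x. scale c (\<alpha> x))"

definition hom_associative ::
    "('f::field \<Rightarrow> 'a::ab_group_add \<Rightarrow> 'a) \<Rightarrow> ('a \<Rightarrow> 'a \<Rightarrow> 'a) \<Rightarrow> ('a \<Rightarrow> 'a) \<Rightarrow> bool" where
  "hom_associative scale mult \<alpha> \<longleftrightarrow> Vector_Spaces.linear scale scale \<alpha> \<and>
     (\<forall>x y z. mult (\<alpha> x) (mult y z) = mult (mult x y) (\<alpha> z))"

definition Twist ::
    "('f::field \<Rightarrow> 'a::ab_group_add \<Rightarrow> 'a) \<Rightarrow> ('a \<Rightarrow> 'a \<Rightarrow> 'a) \<Rightarrow> ('a \<Rightarrow> 'a) set" where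
  "Twist scale mult = {\<alpha> \<in> linear_maps scale. hom_associative scale mult \<alpha>}"

definition multiplicative :: "('a \<Rightarrow> 'a \<Rightarrow> 'a) \<Rightarrow> ('a \<Rightarrow> 'a) \<Rightarrow> bool" where
  "multiplicative mult \<alpha> \<longleftrightarrow> (\<forall>x y. \<alpha> (mult x y) = mult (\<alpha> x) (\<alpha> y))"

definition idempotents :: "('a \<Rightarrow> 'a \<Rightarrow> 'a) \<Rightarrow> 'a set" where
  "idempotents mult = {e. mult e e = e}"

(* Pitfall: a \<mapsto> L_a = mult a need not be injective on AC_l, and AC_l need not be commutative, even if
   the algebra is associative. For x \<cdot> y = f(x) y with f a linear functional and f(1_l) = 1,
   AC_l is the whole algebra and L_a = f(a) id. *)

definition AC_l :: "('a \<Rightarrow> 'a \<Rightarrow> 'a) \<Rightarrow> 'a set" where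
  "AC_l mult = {a. \<forall>x y z. mult a (mult x z) = mult x (mult a z) \<and>
     mult (mult a x) (mult y z) = mult a (mult (mult x y) z)}"

definition AC_l_one :: "('a \<Rightarrow> 'a \<Rightarrow> 'a) \<Rightarrow> 'a \<Rightarrow> 'a set" where
  "AC_l_one mult e = {mult a e | a. a \<in> AC_l mult}"

definition phi :: "'a \<Rightarrow> ('a \<Rightarrow> 'a) \<Rightarrow> 'a" where
  "phi e \<alpha> = \<alpha> e"

definition psi :: "('a \<Rightarrow> 'a \<Rightarrow> 'a) \<Rightarrow> 'a \<Rightarrow> ('a \<Rightarrow> 'a)" where
  "psi mult a = (\<lambda>x. mult a x)"

definition associator :: "('a::minus \<Rightarrow> 'a \<Rightarrow> 'a) \<Rightarrow> 'a \<Rightarrow> 'a \<Rightarrow> 'a \<Rightarrow> 'a" where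
  "associator mult x y z = mult (mult x y) z - mult x (mult y z)"

definition associators :: "('a::minus \<Rightarrow> 'a \<Rightarrow> 'a) \<Rightarrow> 'a set" where
  "associators mult = {associator mult x y z | x y z. True}"

definition products ::
    "('f::field \<Rightarrow> 'a::ab_group_add \<Rightarrow> 'a) \<Rightarrow> ('a \<Rightarrow> 'a \<Rightarrow> 'a) \<Rightarrow> 'a set" where
  "products scale mult = module.span scale {mult x y | x y. True}"

(* The centre of a subalgebra S, not the centralizer of S in the ambient algebra. *)

definition center_of :: "('a \<Rightarrow> 'a \<Rightarrow> 'a) \<Rightarrow> 'a set \<Rightarrow> 'a set" where
  "center_of mult S = {a \<in> S. \<forall>x\<in>S. mult a x = mult x a}"

definition left_nucleus :: "('a::ab_group_add \<Rightarrow> 'a \<Rightarrow> 'a) \<Rightarrow> 'a set" where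
  "left_nucleus mult = {a. \<forall>s t. associator mult a s t = 0}"

definition middle_nucleus :: "('a::ab_group_add \<Rightarrow> 'a \<Rightarrow> 'a) \<Rightarrow> 'a set" where
  "middle_nucleus mult = {a. \<forall>s t. associator mult s a t = 0}"

definition left_annihilator :: "('a::zero \<Rightarrow> 'a \<Rightarrow> 'a) \<Rightarrow> 'a set \<Rightarrow> 'a set" where
  "left_annihilator mult S = {a. \<forall>s\<in>S. mult a s = 0}"

definition HU_n_l ::
    "('f::field \<Rightarrow> 'a::ab_group_add \<Rightarrow> 'a) \<Rightarrow> ('a \<Rightarrow> 'a \<Rightarrow> 'a) \<Rightarrow> 'a set" where
  "HU_n_l scale mult = center_of mult (products scale mult) \<inter> left_nucleus mult \<inter>
     middle_nucleus mult \<inter> left_annihilator mult (associators mult)"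

end

theory Submission
  imports Defs
begin

text \<open>
  Write $L_a$ for left multiplication by $a$. Putting the left unit into the first two places of
  $\alpha(x)\cdot(y\cdot z) = (x\cdot y)\cdot\alpha(z)$ gives $\alpha = L_a$ with
  $a = \alpha(1_l)$, so every HA-compatible map is a left multiplication. Conversely the two
  defining identities of \<open>AC_l\<close> say exactly that $L_a$ is HA-compatible
  (\<open>AC_l_iff_psi_in_Twist\<close>). Hence \<open>a \<mapsto> L_a\<close> maps \<open>AC_l\<close> onto \<open>Twist\<close>.

  The map $a \mapsto L_a$ need not be injective, but for $a$ in \<open>AC_l\<close> the elements $a$
  and $a\cdot 1_l$ have the same left multiplication. So $a \mapsto a\cdot 1_l$ is a
  projection of \<open>AC_l\<close> that keeps $L_a$, and on its image, where $a = a\cdot 1_l = L_a(1_l)$,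
  evaluation at the left unit recovers $a$. This is the bijection.

  The algebraic structure of \<open>AC_l\<close> comes from $L_{a\cdot b} = L_a L_b = L_b L_a$, which
  makes \<open>AC_l\<close> associative and makes its elements fixed by $a\mapsto a\cdot 1_l$ commute. The
  one point that is not immediate is that a composition of HA-compatible maps is HA-compatible
  in an algebra without associativity or a right unit
  (\<open>hom_associative_comp\<close>); it follows from the exchange law
  $\alpha(\beta(x))\cdot w = \alpha(x)\cdot\beta(w)$ between two HA-compatible maps.

  In an associative algebra the second identity of \<open>AC_l\<close> is void and the first one says
  $(a\cdot x - x\cdot a)\cdot z = 0$ for all $x, z$. So \<open>AC_l\<close> is the centre as soon as the
  algebra is commutative or some $z$ can be cancelled from the right.
\<close>

section \<open>HA-compatible maps as left multiplications\<close>

context left_unital_algebra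
begin

lemma mult_add_left: "mult (a + b) x = mult a x + mult b x"
  and mult_scale_left: "mult (scale c a) x = scale c (mult a x)"
  and mult_add_right: "mult x (a + b) = mult x a + mult x b"
  and mult_scale_right: "mult x (scale c a) = scale c (mult x a)"
  and mult_zero_left: "mult 0 x = 0"
  and mult_zero_right: "mult x 0 = 0"
  and mult_diff_left: "mult (a - b) x = mult a x - mult b x"
proof -
  interpret l: Vector_Spaces.linear scale scale "\<lambda>a. mult a x" by (rule mult_linear_left)
  interpret r: Vector_Spaces.linear scale scale "\<lambda>a. mult x a" by (rule mult_linear_right)
  show "mult (a + b) x = mult a x + mult b x" "mult (scale c a) x = scale c (mult a x)"
    "mult x (a + b) = mult x a + mult x b" "mult x (scale c a) = scale c (mult x a)"
    "mult 0 x = 0" "mult x 0 = 0" "mult (a - b) x = mult a x - mult b x"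
    by (fact l.add l.scale r.add r.scale l.zero r.zero l.diff)+
qed

lemma linear_psi: "Vector_Spaces.linear scale scale (psi mult a)"
  unfolding psi_def by (rule mult_linear_right)

lemma Twist_eq: "Twist scale mult = {\<alpha>. hom_associative scale mult \<alpha>}"
  by (auto simp: Twist_def linear_maps_def hom_associative_def)

lemma hom_associativeD:
  "hom_associative scale mult \<alpha> \<Longrightarrow> mult (\<alpha> x) (mult y z) = mult (mult x y) (\<alpha> z)"
  by (simp add: hom_associative_def)

lemma hom_associative_eq_psi:
  assumes "hom_associative scale mult \<alpha>"
  shows "psi mult (\<alpha> one) = \<alpha>"
proof
  fix z
  show "psi mult (\<alpha> one) z = \<alpha> z"
    using hom_associativeD[OF assms, of one one z] by (simp add: psi_def left_unit)
qed

text \<open>Hom-associativity of $L_a$ with the left unit in the first place amounts to the first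
  identity of \<open>AC_l\<close>, which says that $L_a$ commutes with all left multiplications; given this,
  hom-associativity and the second identity are the same equation.\<close>

lemma AC_l_iff_psi_in_Twist: "a \<in> AC_l mult \<longleftrightarrow> psi mult a \<in> Twist scale mult"
proof
  assume "a \<in> AC_l mult"
  then show "psi mult a \<in> Twist scale mult"
    using linear_psi by (simp add: Twist_eq hom_associative_def AC_l_def psi_def)
next
  assume "psi mult a \<in> Twist scale mult"
  then have H: "mult (mult a x) (mult y z) = mult (mult x y) (mult a z)" for x y z
    using hom_associativeD[of "psi mult a"] by (simp add: Twist_eq psi_def)
  \<comment> \<open>The left unit in the first two places shows that \<open>a\<close> and \<open>a \<cdot> 1\<^sub>l\<close> have the same left
    multiplication.\<close>
  have "mult (mult a one) z = mult a z" for z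
    using H[of one one z] by (simp add: left_unit)
  then have "mult a (mult y z) = mult y (mult a z)" for y z
    using H[of one y z] by (simp add: left_unit)
  then show "a \<in> AC_l mult"
    using H by (simp add: AC_l_def)
qed

lemma psi_image_AC_l: "psi mult ` AC_l mult = Twist scale mult"
proof
  show "psi mult ` AC_l mult \<subseteq> Twist scale mult"
    using AC_l_iff_psi_in_Twist by auto
  show "Twist scale mult \<subseteq> psi mult ` AC_l mult"
  proof
    fix \<alpha> assume "\<alpha> \<in> Twist scale mult"
    then have "psi mult (\<alpha> one) = \<alpha>" "\<alpha> one \<in> AC_l mult"
      using hom_associative_eq_psi[of \<alpha>] by (simp_all add: AC_l_iff_psi_in_Twist Twist_eq)
    then show "\<alpha> \<in> psi mult ` AC_l mult"
      by (metis image_eqI)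
  qed
qed

lemma AC_l_left_commute: "a \<in> AC_l mult \<Longrightarrow> mult a (mult x z) = mult x (mult a z)"
  by (simp add: AC_l_def)

lemma AC_l_hom_associative:
  assumes "a \<in> AC_l mult"
  shows "mult (mult a x) (mult y z) = mult (mult x y) (mult a z)"
  using assms by (simp add: AC_l_def)

lemma psi_mult_one:
  assumes "a \<in> AC_l mult"
  shows "psi mult (mult a one) = psi mult a"
proof
  fix x
  show "psi mult (mult a one) x = psi mult a x"
    using AC_l_hom_associative[OF assms, of one one x] by (simp add: psi_def left_unit)
qed

lemma AC_l_one_eq: "AC_l_one mult one = {a \<in> AC_l mult. mult a one = a}"
proof
  show "AC_l_one mult one \<subseteq> {a \<in> AC_l mult. mult a one = a}"
  proof
    fix b assume "b \<in> AC_l_one mult one"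
    then obtain a where a: "a \<in> AC_l mult" and b: "b = mult a one"
      by (auto simp: AC_l_one_def)
    have "psi mult b = psi mult a"
      using psi_mult_one[OF a] b by simp
    then have "b \<in> AC_l mult" "mult b one = b"
      using a b fun_cong[of "psi mult b" "psi mult a" one]
      by (simp_all add: AC_l_iff_psi_in_Twist psi_def)
    then show "b \<in> {a \<in> AC_l mult. mult a one = a}" by simp
  qed
  show "{a \<in> AC_l mult. mult a one = a} \<subseteq> AC_l_one mult one"
    unfolding AC_l_one_def by force
qed

lemma phi_psi: "a \<in> AC_l_one mult one \<Longrightarrow> phi one (psi mult a) = a"
  by (simp add: AC_l_one_eq phi_def psi_def)

lemma psi_phi: "\<alpha> \<in> Twist scale mult \<Longrightarrow> psi mult (phi one \<alpha>) = \<alpha>"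
  by (simp add: phi_def Twist_eq hom_associative_eq_psi)

lemma phi_in_AC_l_one:
  assumes "\<alpha> \<in> Twist scale mult"
  shows "phi one \<alpha> \<in> AC_l_one mult one"
proof -
  have "phi one \<alpha> \<in> AC_l mult"
    using psi_phi[OF assms] assms by (simp add: AC_l_iff_psi_in_Twist)
  moreover have "mult (phi one \<alpha>) one = phi one \<alpha>"
    using fun_cong[OF psi_phi[OF assms], of one] by (simp add: psi_def phi_def)
  ultimately show ?thesis by (simp add: AC_l_one_eq)
qed

lemma psi_in_Twist: "a \<in> AC_l_one mult one \<Longrightarrow> psi mult a \<in> Twist scale mult"
  by (simp add: AC_l_one_eq AC_l_iff_psi_in_Twist)

lemma bij_betw_phi: "bij_betw (phi one) (Twist scale mult) (AC_l_one mult one)"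
  by (rule bij_betw_byWitness[where f' = "psi mult"])
    (auto simp: psi_phi phi_psi phi_in_AC_l_one psi_in_Twist)

lemma bij_betw_psi: "bij_betw (psi mult) (AC_l_one mult one) (Twist scale mult)"
  by (rule bij_betw_byWitness[where f' = "phi one"])
    (auto simp: psi_phi phi_psi phi_in_AC_l_one psi_in_Twist)

section \<open>Closure under composition and multiplication\<close>

text \<open>Writing $w = 1_l\cdot w$ turns $L_a x\cdot w$ into $(x\cdot 1_l)\cdot L_a w$, which moves
  $L_a$ to the other factor at the cost of a factor $1_l$ on the right of $x$, and this factor cannot
  be cancelled. It is absorbed through $a\cdot(x\cdot 1_l) = x\cdot(a\cdot 1_l)$ instead, because
  $a\cdot 1_l$ acts from the left like $a$.\<close>

lemma AC_l_exchange:
  assumes a: "a \<in> AC_l mult" and b: "b \<in> AC_l mult"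
  shows "mult (mult a (mult b x)) w = mult (mult a x) (mult b w)"
proof -
  note A = AC_l_hom_associative[OF a] and B = AC_l_hom_associative[OF b]
  have A1: "mult (mult a u) v = mult (mult u one) (mult a v)" for u v
    using A[of u one v] by (simp add: left_unit)
  have B1: "mult (mult b u) v = mult (mult u one) (mult b v)" for u v
    using B[of u one v] by (simp add: left_unit)
  have "mult (mult a (mult b x)) w = mult (mult (mult b x) one) (mult a w)"
    by (rule A1)
  also have "\<dots> = mult (mult (mult x one) (mult b one)) (mult a w)"
    by (simp only: B1)
  also have "\<dots> = mult (mult a (mult x one)) (mult (mult b one) w)"
    by (simp only: A)
  also have "\<dots> = mult (mult x (mult a one)) (mult b w)"
    using fun_cong[OF psi_mult_one[OF b], of w]
    by (simp add: psi_def AC_l_left_commute[OF a])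
  also have "\<dots> = mult (mult b x) (mult (mult a one) w)"
    by (simp only: B)
  also have "\<dots> = mult (mult x one) (mult b (mult a w))"
    using fun_cong[OF psi_mult_one[OF a], of w] B1 by (simp add: psi_def)
  also have "\<dots> = mult (mult x one) (mult a (mult b w))"
    by (simp only: AC_l_left_commute[OF a])
  also have "\<dots> = mult (mult a x) (mult b w)"
    by (simp only: A1)
  finally show ?thesis .
qed

lemma hom_associative_comp:
  assumes \<alpha>: "hom_associative scale mult \<alpha>" and \<beta>: "hom_associative scale mult \<beta>"
  shows "hom_associative scale mult (\<alpha> \<circ> \<beta>)"
proof -
  define a b where "a = \<alpha> one" and "b = \<beta> one"
  have \<alpha>a: "\<alpha> = mult a" and \<beta>b: "\<beta> = mult b"
    using hom_associative_eq_psi[OF \<alpha>] hom_associative_eq_psi[OF \<beta>]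
    by (simp_all add: a_def b_def psi_def)
  have a: "a \<in> AC_l mult" and b: "b \<in> AC_l mult"
    using \<alpha> \<beta> \<alpha>a \<beta>b by (simp_all add: AC_l_iff_psi_in_Twist Twist_eq psi_def)
  have "mult ((\<alpha> \<circ> \<beta>) x) (mult y z) = mult (mult x y) ((\<alpha> \<circ> \<beta>) z)" for x y z
  proof -
    have "mult (mult a (mult b x)) (mult y z) = mult (mult a x) (mult b (mult y z))"
      by (rule AC_l_exchange[OF a b])
    also have "\<dots> = mult (mult a x) (mult y (mult b z))"
      by (simp only: AC_l_left_commute[OF b])
    also have "\<dots> = mult (mult x y) (mult a (mult b z))"
      by (rule AC_l_hom_associative[OF a])
    finally show ?thesis by (simp add: \<alpha>a \<beta>b)
  qed
  moreover have "Vector_Spaces.linear scale scale (\<alpha> \<circ> \<beta>)"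
    using \<alpha> \<beta> unfolding hom_associative_def by (auto intro: Vector_Spaces.linear_compose)
  ultimately show ?thesis by (simp add: hom_associative_def)
qed

text \<open>For $x = 1_l\cdot x$ the second identity of \<open>AC_l\<close> moves the brackets in
  $(a\cdot b)\cdot(1_l\cdot x)$ and leaves $a\cdot((b\cdot 1_l)\cdot x)$, where $b\cdot 1_l$
  acts like $b$.\<close>

lemma AC_l_mult_assoc:
  assumes a: "a \<in> AC_l mult" and b: "b \<in> AC_l mult"
  shows "mult (mult a b) x = mult a (mult b x)"
proof -
  have "mult (mult a b) (mult one x) = mult a (mult (mult b one) x)"
    using a by (simp add: AC_l_def)
  then show ?thesis
    using fun_cong[OF psi_mult_one[OF b], of x] by (simp add: left_unit psi_def)
qed

lemma AC_l_mult_closed: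
  assumes a: "a \<in> AC_l mult" and b: "b \<in> AC_l mult"
  shows "mult a b \<in> AC_l mult"
proof -
  have "psi mult (mult a b) = psi mult a \<circ> psi mult b"
    using AC_l_mult_assoc[OF a b] by (auto simp: psi_def)
  then show ?thesis
    using hom_associative_comp a b by (simp add: AC_l_iff_psi_in_Twist Twist_eq)
qed

lemma subspace_AC_l: "subspace (AC_l mult)"
  unfolding subspace_def AC_l_def
  by (simp add: mult_zero_left mult_zero_right mult_add_left mult_add_right
      mult_scale_left mult_scale_right)

lemma subalgebra_AC_l: "subalgebra scale mult (AC_l mult)"
  using subspace_AC_l AC_l_mult_closed by (simp add: subalgebra_def)

lemma associative_on_AC_l: "associative_on mult (AC_l mult)"
  using AC_l_mult_assoc by (simp add: associative_on_def)

lemma subalgebra_AC_l_one: "subalgebra scale mult (AC_l_one mult one)"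
proof -
  have "subspace (AC_l_one mult one)"
    using subspace_AC_l unfolding subspace_def AC_l_one_eq
    by (simp add: mult_zero_left mult_add_left mult_scale_left)
  then show ?thesis
    using AC_l_mult_closed AC_l_mult_assoc by (simp add: subalgebra_def AC_l_one_eq)
qed

lemma associative_on_AC_l_one: "associative_on mult (AC_l_one mult one)"
  using AC_l_mult_assoc by (simp add: associative_on_def AC_l_one_eq)

lemma commutative_on_AC_l_one: "commutative_on mult (AC_l_one mult one)"
  unfolding commutative_on_def
proof (intro ballI)
  fix a b assume "a \<in> AC_l_one mult one" "b \<in> AC_l_one mult one"
  then show "mult a b = mult b a"
    using AC_l_left_commute[of a b one] by (simp add: AC_l_one_eq)
qed

lemma module_scale_map: "module (scale_map scale)"
  by unfold_locales
    (auto simp: scale_map_def fun_eq_iff scale_right_distrib scale_left_distrib)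

lemma subalgebra_Twist: "subalgebra (scale_map scale) (\<circ>) (Twist scale mult)"
proof -
  interpret vector_space_pair scale scale by unfold_locales
  have "module.subspace (scale_map scale) (Twist scale mult)"
    unfolding module.subspace_def[OF module_scale_map] Twist_eq hom_associative_def scale_map_def
    using module_hom_zero linear_compose_add linear_compose_scale_right
    by (simp add: zero_fun_def plus_fun_def mult_zero_left mult_zero_right mult_add_left
        mult_add_right mult_scale_left mult_scale_right)
  then show ?thesis
    using hom_associative_comp by (simp add: subalgebra_def Twist_eq)
qed

section \<open>Multiplicative maps and idempotents\<close>

text \<open>For an idempotent $a$, hom-associativity of $L_a$ at $(a, x, y)$ reads
  $(a\cdot a)\cdot(x\cdot y) = (a\cdot x)\cdot(a\cdot y)$, which is multiplicativity. Conversely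
  multiplicativity at $(1_l, 1_l)$ is idempotency of $a\cdot 1_l$.\<close>

lemma multiplicative_iff_idempotent:
  assumes "a \<in> AC_l_one mult one"
  shows "multiplicative mult (psi mult a) \<longleftrightarrow> a \<in> idempotents mult"
proof
  have a: "a \<in> AC_l mult" "mult a one = a"
    using assms by (simp_all add: AC_l_one_eq)
  show "a \<in> idempotents mult" if "multiplicative mult (psi mult a)"
  proof -
    have "mult a (mult one one) = mult (mult a one) (mult a one)"
      using that unfolding multiplicative_def psi_def by blast
    then show ?thesis
      by (simp add: a left_unit idempotents_def)
  qed
  show "multiplicative mult (psi mult a)" if "a \<in> idempotents mult"
    using that AC_l_hom_associative[OF a(1), of a] by (simp add: multiplicative_def psi_def idempotents_def)
qed

lemma bij_betw_phi_multiplicative: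
  "bij_betw (phi one) {\<alpha> \<in> Twist scale mult. multiplicative mult \<alpha>}
     (idempotents mult \<inter> AC_l_one mult one)"
proof -
  have iff: "multiplicative mult \<alpha> \<longleftrightarrow> phi one \<alpha> \<in> idempotents mult" if "\<alpha> \<in> Twist scale mult" for \<alpha>
    using multiplicative_iff_idempotent[OF phi_in_AC_l_one[OF that]] psi_phi[OF that] by simp
  show ?thesis
    by (rule bij_betw_byWitness[where f' = "psi mult"])
      (auto simp: iff psi_phi phi_psi phi_in_AC_l_one psi_in_Twist)
qed

section \<open>Associative algebras\<close>

lemma AC_l_eq_associative:
  assumes "associative_on mult UNIV"
  shows "AC_l mult = {a. \<forall>x z. mult (mult a x) z = mult (mult x a) z}"
  using assms unfolding associative_on_def AC_l_def by auto

lemma center_subset_AC_l: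
  assumes "associative_on mult UNIV"
  shows "center_of mult UNIV \<subseteq> AC_l mult"
  by (auto simp: AC_l_eq_associative[OF assms] center_of_def)

text \<open>An element of \<open>AC_l\<close> satisfies $(a\cdot x)\cdot 1_l = (x\cdot a)\cdot 1_l$, and
  $1_l$ cancels from the right if it is a right unit or if the algebra is a domain with
  $1_l \neq 0$. An algebra with $1_l = 0$ is zero.\<close>

lemma AC_l_eq_center:
  assumes assoc: "associative_on mult UNIV"
    and cases: "two_sided_unital mult one \<or> associative_domain mult \<or> commutative_on mult UNIV"
  shows "AC_l mult = center_of mult UNIV"
proof
  show "center_of mult UNIV \<subseteq> AC_l mult"
    by (rule center_subset_AC_l[OF assoc])
  show "AC_l mult \<subseteq> center_of mult UNIV"
  proof
    fix a assume "a \<in> AC_l mult"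
    then have eq: "mult (mult a x) one = mult (mult x a) one" for x
      by (simp add: AC_l_eq_associative[OF assoc])
    have "mult a x = mult x a" for x
      using cases
    proof (elim disjE)
      assume "two_sided_unital mult one"
      then show ?thesis using eq[of x] by (simp add: two_sided_unital_def)
    next
      assume dom: "associative_domain mult"
      have zero: "mult (mult a x - mult x a) one = 0"
        using eq[of x] by (simp add: mult_diff_left)
      show ?thesis
      proof (cases "one = 0")
        case True
        then have "u = 0" for u :: 'a using left_unit[of u] by (simp add: mult_zero_left)
        then show ?thesis by metis
      next
        case False
        then have "mult a x - mult x a = 0"
          using dom zero unfolding associative_domain_def by blast
        then show ?thesis by simp
      qed
    next
      assume "commutative_on mult UNIV"
      then show ?thesis by (simp add: commutative_on_def)
    qed
    then show "a \<in> center_of mult UNIV" by (simp add: center_of_def)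
  qed
qed

lemma products_eq_UNIV: "products scale mult = UNIV"
proof -
  have "u \<in> span {mult x y | x y. True}" for u
    using left_unit[of u, symmetric] by (intro span_base) blast
  then show ?thesis by (auto simp: products_def)
qed

text \<open>All associators vanish, so the nuclei and the annihilator of the associators are the whole
  algebra and only the centre is left.\<close>

lemma HU_n_l_eq_center:
  assumes "associative_on mult UNIV"
  shows "HU_n_l scale mult = center_of mult UNIV"
proof -
  have "associator mult x y z = 0" for x y z
    using assms by (simp add: associator_def associative_on_def)
  then show ?thesis
    by (auto simp: HU_n_l_def products_eq_UNIV left_nucleus_def middle_nucleus_def
        left_annihilator_def associators_def mult_zero_right)
qed

text \<open>A central element satisfies $a\cdot 1_l = 1_l\cdot a = a$, so the restriction to
  fixed points of $a\mapsto a\cdot 1_l$ is automatic when \<open>AC_l\<close> is the centre.\<close>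

lemma AC_l_one_eq_AC_l:
  assumes "AC_l mult = center_of mult UNIV"
  shows "AC_l_one mult one = AC_l mult"
  unfolding AC_l_one_eq using assms by (auto simp: center_of_def left_unit)

end

section \<open>The classification of HA-compatible maps\<close>

theorem theorem37:
  fixes scale :: "'f::field \<Rightarrow> 'a::ab_group_add \<Rightarrow> 'a"
    and mult :: "'a \<Rightarrow> 'a \<Rightarrow> 'a"  (infixl \<open>\<cdot>\<close> 70)
    and one :: 'a  (\<open>1\<^sub>l\<close>)
  assumes "left_unital_algebra scale (\<cdot>) 1\<^sub>l"
  shows
    "(subalgebra (scale_map scale) (\<circ>) (Twist scale (\<cdot>)) \<and>
      subalgebra scale (\<cdot>) (AC_l_one (\<cdot>) 1\<^sub>l) \<and>
      commutative_on (\<cdot>) (AC_l_one (\<cdot>) 1\<^sub>l) \<and>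
      associative_on (\<cdot>) (AC_l_one (\<cdot>) 1\<^sub>l) \<and>
      AC_l_one (\<cdot>) 1\<^sub>l = {a \<in> AC_l (\<cdot>). a \<cdot> 1\<^sub>l = a} \<and>
      psi (\<cdot>) ` AC_l (\<cdot>) \<subseteq> linear_maps scale \<and>
      bij_betw (phi 1\<^sub>l) (Twist scale (\<cdot>)) (AC_l_one (\<cdot>) 1\<^sub>l) \<and>
      bij_betw (psi (\<cdot>)) (AC_l_one (\<cdot>) 1\<^sub>l) (Twist scale (\<cdot>)) \<and>
      (\<forall>\<alpha>\<in>Twist scale (\<cdot>). psi (\<cdot>) (phi 1\<^sub>l \<alpha>) = \<alpha>) \<and>
      (\<forall>a\<in>AC_l_one (\<cdot>) 1\<^sub>l. phi 1\<^sub>l (psi (\<cdot>) a) = a))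
   \<and> (\<forall>a\<in>AC_l (\<cdot>). hom_associative scale (\<cdot>) (psi (\<cdot>) a))
   \<and> bij_betw (phi 1\<^sub>l) {\<alpha> \<in> Twist scale (\<cdot>). multiplicative (\<cdot>) \<alpha>}
       (idempotents (\<cdot>) \<inter> AC_l_one (\<cdot>) 1\<^sub>l)
   \<and> (associative_on (\<cdot>) UNIV \<longrightarrow>
        AC_l (\<cdot>) = {a. \<forall>x z. a \<cdot> x \<cdot> z = x \<cdot> a \<cdot> z} \<and>
        subalgebra scale (\<cdot>) (AC_l (\<cdot>)) \<and>
        associative_on (\<cdot>) (AC_l (\<cdot>)) \<and>
        psi (\<cdot>) ` AC_l (\<cdot>) = Twist scale (\<cdot>) \<and>
        AC_l_one (\<cdot>) 1\<^sub>l = {a. (\<forall>x z. a \<cdot> x \<cdot> z = x \<cdot> a \<cdot> z) \<and> a \<cdot> 1\<^sub>l = a} \<and>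
        bij_betw (psi (\<cdot>)) (AC_l_one (\<cdot>) 1\<^sub>l) (Twist scale (\<cdot>)) \<and>
        center_of (\<cdot>) UNIV \<subseteq> AC_l (\<cdot>) \<and>
        (two_sided_unital (\<cdot>) 1\<^sub>l \<or> associative_domain (\<cdot>) \<or> commutative_on (\<cdot>) UNIV \<longrightarrow>
           commutative_on (\<cdot>) (AC_l (\<cdot>)) \<and>
           bij_betw (psi (\<cdot>)) (AC_l (\<cdot>)) (Twist scale (\<cdot>)) \<and>
           AC_l (\<cdot>) = center_of (\<cdot>) UNIV \<and>
           center_of (\<cdot>) UNIV = AC_l_one (\<cdot>) 1\<^sub>l \<and>
           AC_l_one (\<cdot>) 1\<^sub>l = HU_n_l scale (\<cdot>)))"
proof -
  interpret left_unital_algebra scale mult one by (fact assms)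
  have hom: "\<forall>a\<in>AC_l (\<cdot>). hom_associative scale (\<cdot>) (psi (\<cdot>) a)"
    using AC_l_iff_psi_in_Twist by (simp add: Twist_eq)
  have lin: "psi (\<cdot>) ` AC_l (\<cdot>) \<subseteq> linear_maps scale"
    using linear_psi by (auto simp: linear_maps_def)
  have one: "AC_l_one (\<cdot>) 1\<^sub>l = {a. (\<forall>x z. a \<cdot> x \<cdot> z = x \<cdot> a \<cdot> z) \<and> a \<cdot> 1\<^sub>l = a}"
    if "associative_on (\<cdot>) UNIV"
    using AC_l_one_eq AC_l_eq_associative[OF that] by simp
  have coll: "commutative_on (\<cdot>) (AC_l (\<cdot>)) \<and>
      bij_betw (psi (\<cdot>)) (AC_l (\<cdot>)) (Twist scale (\<cdot>)) \<and>
      AC_l (\<cdot>) = center_of (\<cdot>) UNIV \<and>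
      center_of (\<cdot>) UNIV = AC_l_one (\<cdot>) 1\<^sub>l \<and>
      AC_l_one (\<cdot>) 1\<^sub>l = HU_n_l scale (\<cdot>)"
    if assoc: "associative_on (\<cdot>) UNIV"
      and cases: "two_sided_unital (\<cdot>) 1\<^sub>l \<or> associative_domain (\<cdot>) \<or> commutative_on (\<cdot>) UNIV"
  proof -
    have Z: "AC_l (\<cdot>) = center_of (\<cdot>) UNIV"
      by (rule AC_l_eq_center[OF assoc cases])
    have "AC_l_one (\<cdot>) 1\<^sub>l = AC_l (\<cdot>)"
      by (rule AC_l_one_eq_AC_l[OF Z])
    then show ?thesis
      using Z commutative_on_AC_l_one bij_betw_psi HU_n_l_eq_center[OF assoc] by simp
  qed
  show ?thesis
    by (intro conjI impI)
      (use subalgebra_Twist subalgebra_AC_l_one commutative_on_AC_l_one associative_on_AC_l_one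
        AC_l_one_eq lin bij_betw_phi bij_betw_psi psi_phi phi_psi hom bij_betw_phi_multiplicative
        AC_l_eq_associative subalgebra_AC_l associative_on_AC_l psi_image_AC_l one
        center_subset_AC_l coll in blast)+
qed

end
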